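(* Let $X$ be a Hausdorff space having a uniform base and let $A\subset X$. Let $X_A$ be the discretizable space of $X$ by $A$. Then there exist a Hausdorff space $H$ having a uniform base and a continuous surjection $f:H\to X_A$ which is an open map, a compact map, and an at most boundary-one map.
   Context: All spaces are Hausdorff and all maps are continuous and onto. For a family $\mathcal P$ of subsets of $X$ and $x\in X$, write $(\mathcal P)_x=\{P\in\mathcal P: x\in P\}$. A base $\mathcal P$ of $X$ is a uniform base if for each point $x\in X$ and each countably infinite subset $\mathcal P'$ of $(\mathcal P)_x$, $\mathcal P'$ is a neighborhood base at $x$. If $(X,\tau)$ is a space and $A\subset X$, the discretizable space $X_A$ is the set $X$ endowed with the topology having $\tau\cup\{\{x\}:x\in A\}$ as a base. A map $f:H\to Y$ is compact if each fiber $f^{-1}(y)$ is compact; it is at most boundary-one if each boundary $\partial f^{-1}(y)$ has at most one point; it is open if images of open sets are open. *)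

theory Defs
  imports "HOL-Analysis.Analysis"
begin

definition base_of_topology :: "'a topology \<Rightarrow> 'a set set \<Rightarrow> bool"
  where "base_of_topology X P \<longleftrightarrow> openin X = arbitrary union_of (\<lambda>U. U \<in> P)"

definition uniform_base :: "'a topology \<Rightarrow> 'a set set \<Rightarrow> bool"
  where "uniform_base X P \<longleftrightarrow>
    base_of_topology X P \<and>
    (\<forall>x \<in> topspace X. \<forall>Q. Q \<subseteq> {U \<in> P. x \<in> U} \<and> countable Q \<and> infinite Q \<longrightarrow>
       neighbourhood_base_at x (\<lambda>U. U \<in> Q) X)"

definition has_uniform_base :: "'a topology \<Rightarrow> bool"
  where "has_uniform_base X \<longleftrightarrow> (\<exists>P. uniform_base X P)"

definition discretizable_space :: "'a topology \<Rightarrow> 'a set \<Rightarrow> 'a topology"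
  where "discretizable_space X A =
    topology (arbitrary union_of (\<lambda>U. openin X U \<or> (\<exists>x \<in> A. U = {x})))"

text \<open>The family in the previous definition is closed under binary intersections,
  so it is indeed a base of a topology.\<close>

lemma openin_discretizable_space:
  "openin (discretizable_space X A) =
     arbitrary union_of (\<lambda>U. openin X U \<or> (\<exists>x \<in> A. U = {x}))"
proof -
  have "istopology (arbitrary union_of (\<lambda>U. openin X U \<or> (\<exists>x \<in> A. U = {x})))"
  proof (rule istopology_base)
    fix S T
    assume S: "openin X S \<or> (\<exists>x \<in> A. S = {x})" and T: "openin X T \<or> (\<exists>x \<in> A. T = {x})"
    show "openin X (S \<inter> T) \<or> (\<exists>x \<in> A. S \<inter> T = {x})"
    proof (cases "openin X S \<and> openin X T")
      case True
      then show ?thesis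
        by (simp add: openin_Int)
    next
      case False
      with S T have "S \<inter> T = {} \<or> (\<exists>x \<in> A. S \<inter> T = {x})"
        by blast
      then show ?thesis
        by (metis openin_empty)
    qed
  qed
  then show ?thesis
    by (simp add: discretizable_space_def)
qed

lemma topspace_discretizable_space:
  assumes "A \<subseteq> topspace X"
  shows "topspace (discretizable_space X A) = topspace X"
proof (rule antisym)
  show "topspace (discretizable_space X A) \<subseteq> topspace X"
  proof
    fix x assume "x \<in> topspace (discretizable_space X A)"
    then obtain U where U: "openin (discretizable_space X A) U" "x \<in> U"
      by (auto simp: topspace_def)
    then have "\<exists>V. (openin X V \<or> (\<exists>y \<in> A. V = {y})) \<and> x \<in> V"
      by (auto simp: openin_discretizable_space union_of_def arbitrary_def)
    then show "x \<in> topspace X"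
      using assms by (auto dest: openin_subset)
  qed
  show "topspace X \<subseteq> topspace (discretizable_space X A)"
    by (rule openin_subset)
      (simp add: openin_discretizable_space arbitrary_union_of_inc)
qed

definition fibre :: "'a topology \<Rightarrow> ('a \<Rightarrow> 'b) \<Rightarrow> 'b \<Rightarrow> 'a set"
  where "fibre X f y = {x \<in> topspace X. f x = y}"

definition compact_map :: "'a topology \<Rightarrow> 'b topology \<Rightarrow> ('a \<Rightarrow> 'b) \<Rightarrow> bool"
  where "compact_map X Y f \<longleftrightarrow> (\<forall>y \<in> topspace Y. compactin X (fibre X f y))"

definition at_most_boundary_one_map :: "'a topology \<Rightarrow> 'b topology \<Rightarrow> ('a \<Rightarrow> 'b) \<Rightarrow> bool"
  where "at_most_boundary_one_map X Y f \<longleftrightarrow>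
    (\<forall>y \<in> topspace Y. \<exists>p. X frontier_of (fibre X f y) \<subseteq> {p})"

end

theory Submission
  imports Defs
begin

text \<open>Given a uniform base \<open>P\<close>, every nonempty \<open>U \<in> P\<close> lies in only finitely many members of \<open>P\<close>;
  let \<open>r U\<close> be their number. A point lies in only finitely many members of rank at most \<open>k\<close>.
  The space \<open>H\<close> has one point over each \<open>x \<notin> A\<close> and a convergent sequence over each \<open>a \<in> A\<close>,
  open in \<open>H\<close> and with limit \<open>(a, 0)\<close>. A member \<open>U\<close> of \<open>P\<close> is lifted to \<open>H\<close> by taking only those
  terms \<open>(a, k)\<close> with \<open>k > r U\<close>. Hence each isolated point \<open>(a, k)\<close> lies in finitely many lifts,
  and since the lift is monotone, the lifts form a uniform base at the points over \<open>X - A\<close>.\<close>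

section \<open>Uniform bases and discretizable spaces in terms of points\<close>

lemma uniform_base_iff:
  "uniform_base X P \<longleftrightarrow>
    (\<forall>U\<in>P. openin X U) \<and>
    (\<forall>W x. openin X W \<and> x \<in> W \<longrightarrow> (\<exists>U\<in>P. x \<in> U \<and> U \<subseteq> W)) \<and>
    (\<forall>x W Q. Q \<subseteq> P \<and> x \<in> \<Inter>Q \<and> infinite Q \<and> openin X W \<and> x \<in> W \<longrightarrow> (\<exists>U\<in>Q. U \<subseteq> W))"
  (is "_ \<longleftrightarrow> ?open \<and> ?base \<and> ?unif")
proof -
  have base: "base_of_topology X P \<longleftrightarrow> ?open \<and> ?base"
    unfolding base_of_topology_def openin_topology_base_unique by blast
  have "(\<forall>x \<in> topspace X. \<forall>Q. Q \<subseteq> {U \<in> P. x \<in> U} \<and> countable Q \<and> infinite Q \<longrightarrow>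
       neighbourhood_base_at x (\<lambda>U. U \<in> Q) X) \<longleftrightarrow> ?unif" (is "?nb \<longleftrightarrow> _") if "?open"
  proof
    assume nb: ?nb
    show ?unif
    proof clarify
      fix x W Q
      assume Q: "Q \<subseteq> P" "x \<in> \<Inter>Q" "infinite Q" and W: "openin X W" "x \<in> W"
      obtain R where R: "R \<subseteq> Q" "countable R" "infinite R"
        using infinite_countable_subset'[OF Q(3)] by blast
      have "x \<in> topspace X"
        using W openin_subset by blast
      moreover have "R \<subseteq> {U \<in> P. x \<in> U}"
        using Q R by blast
      ultimately have "neighbourhood_base_at x (\<lambda>U. U \<in> R) X"
        using nb R by blast
      then show "\<exists>U\<in>Q. U \<subseteq> W"
        using W R unfolding neighbourhood_base_at_def by blast
    qed
  next
    assume unif: ?unif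
    show ?nb
    proof (intro ballI allI impI)
      fix x Q
      assume "x \<in> topspace X" and Q: "Q \<subseteq> {U \<in> P. x \<in> U} \<and> countable Q \<and> infinite Q"
      show "neighbourhood_base_at x (\<lambda>U. U \<in> Q) X"
        unfolding neighbourhood_base_at_def
      proof (intro allI impI)
        fix W assume W: "openin X W \<and> x \<in> W"
        have "Q \<subseteq> P" "x \<in> \<Inter>Q"
          using Q by auto
        then obtain U where "U \<in> Q" "U \<subseteq> W"
          using unif Q W by blast
        then show "\<exists>U V. openin X U \<and> V \<in> Q \<and> x \<in> U \<and> U \<subseteq> V \<and> V \<subseteq> W"
          using Q that by blast
      qed
    qed
  qed
  then show ?thesis
    unfolding uniform_base_def base conj_assoc by (intro conj_cong refl)
qed

lemma uniform_base_openin: "uniform_base X P \<Longrightarrow> U \<in> P \<Longrightarrow> openin X U"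
  by (simp add: uniform_base_iff)

lemma uniform_base_obtain:
  assumes "uniform_base X P" "openin X W" "x \<in> W"
  obtains U where "U \<in> P" "x \<in> U" "U \<subseteq> W"
  using conjunct1[OF conjunct2[OF assms(1)[unfolded uniform_base_iff]]] assms(2,3) that by metis

lemma uniform_base_obtain_infinite:
  assumes "uniform_base X P" "Q \<subseteq> P" "x \<in> \<Inter>Q" "infinite Q" "openin X W" "x \<in> W"
  obtains U where "U \<in> Q" "U \<subseteq> W"
proof -
  have "\<exists>U\<in>Q. U \<subseteq> W"
    using conjunct2[OF conjunct2[OF assms(1)[unfolded uniform_base_iff]]] assms(2-6)
    by (elim allE impE) (intro conjI)
  then show thesis
    using that by blast
qed

text \<open>Points of \<open>A\<close> are isolated, so only the points of \<open>W - A\<close>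
  impose a condition.\<close>

lemma openin_discretizable_space_iff:
  assumes "A \<subseteq> topspace X"
  shows "openin (discretizable_space X A) W \<longleftrightarrow>
    W \<subseteq> topspace X \<and> (\<forall>x\<in>W - A. \<exists>U. openin X U \<and> x \<in> U \<and> U \<subseteq> W)"
proof
  assume W: "openin (discretizable_space X A) W"
  then have "\<forall>x\<in>W. \<exists>U. (openin X U \<or> (\<exists>x\<in>A. U = {x})) \<and> x \<in> U \<and> U \<subseteq> W"
    unfolding openin_discretizable_space union_of_def arbitrary_def by blast
  then show "W \<subseteq> topspace X \<and> (\<forall>x\<in>W - A. \<exists>U. openin X U \<and> x \<in> U \<and> U \<subseteq> W)"
    using openin_subset[OF W] topspace_discretizable_space[OF assms] by fast
next
  assume R: "W \<subseteq> topspace X \<and> (\<forall>x\<in>W - A. \<exists>U. openin X U \<and> x \<in> U \<and> U \<subseteq> W)"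
  have "\<exists>U. (openin X U \<or> (\<exists>x\<in>A. U = {x})) \<and> x \<in> U \<and> U \<subseteq> W" if "x \<in> W" for x
    using R that by (cases "x \<in> A") blast+
  then show "openin (discretizable_space X A) W"
    by (simp add: openin_discretizable_space arbitrary_union_of_alt)
qed

section \<open>The rank of a member of a uniform base\<close>

text \<open>\<open>card\<close> returns 0 on infinite sets. For \<open>U \<in> P\<close> in a
  uniform base this default can occur only when \<open>U\<close> is empty, and then the lift of
  \<open>U\<close> is empty whatever its rank.\<close>

definition base_rank :: "'a set set \<Rightarrow> 'a set \<Rightarrow> nat"
  where "base_rank P U = card {V \<in> P. U \<subseteq> V}"

text \<open>Otherwise the proper supersets of \<open>U\<close> in \<open>P\<close> would form an
  infinite family around \<open>x\<close>, and uniformity would put one of them inside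
  \<open>U\<close>.\<close>

lemma finite_supersets_uniform_base:
  assumes "uniform_base X P" "U \<in> P" "x \<in> U"
  shows "finite {V \<in> P. U \<subseteq> V}"
proof (rule ccontr)
  assume inf: "infinite {V \<in> P. U \<subseteq> V}"
  let ?Q = "{V \<in> P. U \<subseteq> V} - {U}"
  have Q: "?Q \<subseteq> P" "x \<in> \<Inter>?Q" "infinite ?Q"
    using assms(3) inf by auto
  obtain V where "V \<in> ?Q" "V \<subseteq> U"
    using uniform_base_obtain_infinite[OF assms(1) Q uniform_base_openin[OF assms(1,2)] assms(3)] .
  then show False
    by blast
qed

lemma base_rank_mono:
  assumes "uniform_base X P" "U \<in> P" "x \<in> U" "U \<subseteq> V"
  shows "base_rank P V \<le> base_rank P U"
  unfolding base_rank_def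
  using assms(4) by (intro card_mono[OF finite_supersets_uniform_base[OF assms(1-3)]]) auto

text \<open>\<open>U\<close> itself is counted for \<open>U\<close> but not for
  \<open>V\<close>.\<close>

lemma base_rank_strict_mono:
  assumes "uniform_base X P" "U \<in> P" "x \<in> U" "U \<subset> V"
  shows "base_rank P V < base_rank P U"
  unfolding base_rank_def
  using assms(2,4) by (intro psubset_card_mono[OF finite_supersets_uniform_base[OF assms(1-3)]]) auto

text \<open>In an infinite family of this kind, take \<open>U\<close> of greatest rank, which exists
  because ranks are bounded by \<open>k\<close>. The other members still form an infinite family
  around \<open>x\<close>, so one of them lies properly inside \<open>U\<close> and has larger
  rank.\<close>

lemma finite_base_rank_le:
  assumes "uniform_base X P"
  shows "finite {U \<in> P. x \<in> U \<and> base_rank P U \<le> k}" (is "finite ?Q")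
proof (rule ccontr)
  assume inf: "infinite ?Q"
  then obtain U0 where "U0 \<in> ?Q"
    by (metis (lifting) ex_in_conv finite.emptyI)
  then have "\<exists>U. U \<in> ?Q \<and> (\<forall>V. V \<in> ?Q \<longrightarrow> base_rank P V \<le> base_rank P U)"
    by (rule ex_has_greatest_nat[where b = "Suc k"]) simp
  then obtain U where U: "U \<in> ?Q" "\<And>V. V \<in> ?Q \<Longrightarrow> base_rank P V \<le> base_rank P U"
    by blast
  then have UP: "U \<in> P" "x \<in> U"
    by simp_all
  have Q: "?Q - {U} \<subseteq> P" "x \<in> \<Inter>(?Q - {U})" "infinite (?Q - {U})"
    using inf by auto
  obtain V where V: "V \<in> ?Q - {U}" "V \<subseteq> U"
    using uniform_base_obtain_infinite[OF assms Q uniform_base_openin[OF assms UP(1)] UP(2)] .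
  then have "base_rank P U < base_rank P V"
    using base_rank_strict_mono[OF assms, of V x U] by blast
  then show False
    using U(2)[of V] V by simp
qed

section \<open>The space over \<open>X\<close> and its open sets\<close>

text \<open>The limits \<open>(a, 0)\<close> with \<open>a \<in> A\<close> are left out on purpose.
  If \<open>a\<close> is not isolated in \<open>X\<close>, infinitely many members of
  \<open>P\<close> contain it, and none of their lifts would fit inside the fibre over
  \<open>a\<close>, which would break uniformity at \<open>(a, 0)\<close>.\<close>

definition lift_set :: "'a set \<Rightarrow> 'a set set \<Rightarrow> 'a set \<Rightarrow> ('a \<times> nat) set"
  where "lift_set A P U = (U - A) \<times> {0} \<union> (U \<inter> A) \<times> {base_rank P U<..}"

definition seq_tail :: "'a \<Rightarrow> nat \<Rightarrow> ('a \<times> nat) set"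
  where "seq_tail a m = {a} \<times> insert 0 {m<..}"

text \<open>The topology is given by neighbourhoods: lifts at \<open>(x, 0)\<close> for
  \<open>x \<notin> A\<close>, tails at the limits \<open>(a, 0)\<close>. Nothing is demanded at
  \<open>(a, k)\<close> with \<open>k > 0\<close>, which makes these points isolated.\<close>

definition lift_space :: "'a topology \<Rightarrow> 'a set \<Rightarrow> 'a set set \<Rightarrow> ('a \<times> nat) topology"
  where "lift_space X A P = topology (\<lambda>W.
    W \<subseteq> (topspace X - A) \<times> {0} \<union> A \<times> UNIV \<and>
    (\<forall>x. x \<notin> A \<and> (x, 0) \<in> W \<longrightarrow> (\<exists>U\<in>P. x \<in> U \<and> lift_set A P U \<subseteq> W)) \<and>
    (\<forall>a\<in>A. (a, 0) \<in> W \<longrightarrow> (\<exists>m. seq_tail a m \<subseteq> W)))"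

text \<open>A larger set has smaller rank, so its lift keeps more terms of each sequence. The empty
  set is treated apart, since monotonicity of the rank needs a point of \<open>U\<close>.\<close>

lemma lift_set_mono:
  assumes "uniform_base X P" "U \<in> P" "U \<subseteq> V"
  shows "lift_set A P U \<subseteq> lift_set A P V"
proof (cases "U = {}")
  case False
  then have "base_rank P V \<le> base_rank P U"
    using base_rank_mono[OF assms(1,2) _ assms(3)] by blast
  then show ?thesis
    using assms(3) by (auto simp: lift_set_def)
qed (simp add: lift_set_def)

text \<open>Over each \<open>a \<in> U \<inter> A\<close> the terms beyond the rank survive, so no
  point of \<open>U\<close> is lost. This is what makes \<open>fst\<close> open.\<close>

lemma fst_lift_set: "fst ` lift_set A P U = U"
proof -
  have "x \<in> fst ` lift_set A P U" if "x \<in> U" for x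
    using that by (cases "x \<in> A") (force simp: lift_set_def)+
  then show ?thesis
    by (auto simp: lift_set_def)
qed

lemma seq_tail_antimono: "m \<le> n \<Longrightarrow> seq_tail a n \<subseteq> seq_tail a m"
  by (auto simp: seq_tail_def)

text \<open>The defining predicate is a topology. For intersections, a member of \<open>P\<close>
  inside \<open>U \<inter> V\<close> has its lift inside both lifts by \<open>lift_set_mono\<close>,
  and of two tails at \<open>a\<close> the one starting later lies in both.\<close>

lemma openin_lift_space:
  assumes "uniform_base X P"
  shows "openin (lift_space X A P) W \<longleftrightarrow>
    W \<subseteq> (topspace X - A) \<times> {0} \<union> A \<times> UNIV \<and>
    (\<forall>x. x \<notin> A \<and> (x, 0) \<in> W \<longrightarrow> (\<exists>U\<in>P. x \<in> U \<and> lift_set A P U \<subseteq> W)) \<and>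
    (\<forall>a\<in>A. (a, 0) \<in> W \<longrightarrow> (\<exists>m. seq_tail a m \<subseteq> W))"
proof -
  let ?op = "\<lambda>W. W \<subseteq> (topspace X - A) \<times> {0} \<union> A \<times> UNIV \<and>
    (\<forall>x. x \<notin> A \<and> (x, 0) \<in> W \<longrightarrow> (\<exists>U\<in>P. x \<in> U \<and> lift_set A P U \<subseteq> W)) \<and>
    (\<forall>a\<in>A. (a, 0::nat) \<in> W \<longrightarrow> (\<exists>m. seq_tail a m \<subseteq> W))"
  have "istopology ?op"
    unfolding istopology_def
  proof (intro conjI allI impI)
    fix S T assume S: "?op S" and T: "?op T"
    have "\<exists>U\<in>P. x \<in> U \<and> lift_set A P U \<subseteq> S \<inter> T" if x: "x \<notin> A" "(x, 0) \<in> S \<inter> T" for x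
    proof -
      have "\<exists>U\<in>P. x \<in> U \<and> lift_set A P U \<subseteq> S" "\<exists>V\<in>P. x \<in> V \<and> lift_set A P V \<subseteq> T"
        using S T x by simp_all
      then obtain U V where UV: "U \<in> P" "x \<in> U" "lift_set A P U \<subseteq> S"
          "V \<in> P" "x \<in> V" "lift_set A P V \<subseteq> T"
        by auto
      have "openin X (U \<inter> V)" "x \<in> U \<inter> V"
        using UV uniform_base_openin[OF assms] by auto
      then obtain W where W: "W \<in> P" "x \<in> W" "W \<subseteq> U \<inter> V"
        by (rule uniform_base_obtain[OF assms])
      then have "lift_set A P W \<subseteq> lift_set A P U" "lift_set A P W \<subseteq> lift_set A P V"
        by (simp_all add: lift_set_mono[OF assms])
      then show ?thesis
        using UV W by blast
    qed
    moreover have "\<exists>m. seq_tail a m \<subseteq> S \<inter> T" if a: "a \<in> A" "(a, 0) \<in> S \<inter> T" for a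
    proof -
      have "\<exists>m. seq_tail a m \<subseteq> S" "\<exists>n. seq_tail a n \<subseteq> T"
        using S T a by simp_all
      then obtain m n where "seq_tail a m \<subseteq> S" "seq_tail a n \<subseteq> T"
        by auto
      then have "seq_tail a (max m n) \<subseteq> S \<inter> T"
        using seq_tail_antimono[of m "max m n" a] seq_tail_antimono[of n "max m n" a] by auto
      then show ?thesis ..
    qed
    ultimately show "S \<inter> T \<subseteq> (topspace X - A) \<times> {0} \<union> A \<times> UNIV"
      "\<And>x. x \<notin> A \<and> (x, 0) \<in> S \<inter> T \<Longrightarrow> \<exists>U\<in>P. x \<in> U \<and> lift_set A P U \<subseteq> S \<inter> T"
      "\<forall>a\<in>A. (a, 0) \<in> S \<inter> T \<longrightarrow> (\<exists>m. seq_tail a m \<subseteq> S \<inter> T)"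
      using S by (simp_all add: le_infI1)
  next
    fix \<K> assume K: "\<forall>K\<in>\<K>. ?op K"
    then show "\<Union>\<K> \<subseteq> (topspace X - A) \<times> {0} \<union> A \<times> UNIV"
      by (intro Union_least) simp
    show "\<exists>U\<in>P. x \<in> U \<and> lift_set A P U \<subseteq> \<Union>\<K>" if x: "x \<notin> A \<and> (x, 0) \<in> \<Union>\<K>" for x
    proof -
      obtain K where "K \<in> \<K>" "(x, 0) \<in> K"
        using x by blast
      moreover from this have "\<exists>U\<in>P. x \<in> U \<and> lift_set A P U \<subseteq> K"
        using K x by simp
      ultimately show ?thesis
        by blast
    qed
    show "\<forall>a\<in>A. (a, 0) \<in> \<Union>\<K> \<longrightarrow> (\<exists>m. seq_tail a m \<subseteq> \<Union>\<K>)"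
    proof (intro ballI impI)
      fix a assume a: "a \<in> A" "(a, 0) \<in> \<Union>\<K>"
      then obtain K where "K \<in> \<K>" "(a, 0) \<in> K"
        by blast
      moreover from this have "\<exists>m. seq_tail a m \<subseteq> K"
        using K a by simp
      ultimately show "\<exists>m. seq_tail a m \<subseteq> \<Union>\<K>"
        by blast
    qed
  qed
  then show ?thesis
    unfolding lift_space_def by (simp only: topology_inverse')
qed

lemma openin_lift_spaceI:
  assumes "uniform_base X P" "W \<subseteq> (topspace X - A) \<times> {0} \<union> A \<times> UNIV"
    and "\<And>x. x \<notin> A \<Longrightarrow> (x, 0) \<in> W \<Longrightarrow> \<exists>U\<in>P. x \<in> U \<and> lift_set A P U \<subseteq> W"
    and "\<And>a. a \<in> A \<Longrightarrow> (a, 0) \<in> W \<Longrightarrow> \<exists>m. seq_tail a m \<subseteq> W"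
  shows "openin (lift_space X A P) W"
  unfolding openin_lift_space[OF assms(1)]
  by (intro conjI allI ballI impI assms(2-4)) auto

lemma openin_lift_space_subset:
  assumes "uniform_base X P" "openin (lift_space X A P) W"
  shows "W \<subseteq> (topspace X - A) \<times> {0} \<union> A \<times> UNIV"
  by (rule conjunct1[OF iffD1[OF openin_lift_space[OF assms(1)] assms(2)]])

lemma openin_lift_space_obtain_lift_set:
  assumes "uniform_base X P" "openin (lift_space X A P) W" "(x, 0) \<in> W" "x \<notin> A"
  obtains U where "U \<in> P" "x \<in> U" "lift_set A P U \<subseteq> W"
  using conjunct1[OF conjunct2[OF iffD1[OF openin_lift_space[OF assms(1)] assms(2)]]]
    assms(3,4) that by metis

lemma openin_lift_space_obtain_seq_tail:
  assumes "uniform_base X P" "openin (lift_space X A P) W" "(a, 0) \<in> W" "a \<in> A"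
  obtains m where "seq_tail a m \<subseteq> W"
  using conjunct2[OF conjunct2[OF iffD1[OF openin_lift_space[OF assms(1)] assms(2)]]]
    assms(3,4) that by metis

lemma openin_lift_space_lift_set:
  assumes "uniform_base X P" "U \<in> P"
  shows "openin (lift_space X A P) (lift_set A P U)"
proof -
  have "U \<subseteq> topspace X"
    using assms uniform_base_openin openin_subset by blast
  then have "lift_set A P U \<subseteq> (topspace X - A) \<times> {0} \<union> A \<times> UNIV"
    by (auto simp: lift_set_def)
  moreover have "x \<in> U" if "(x, 0) \<in> lift_set A P U" for x
    using that by (auto simp: lift_set_def)
  moreover have "(a, 0) \<notin> lift_set A P U" if "a \<in> A" for a
    using that by (simp add: lift_set_def)
  ultimately show ?thesis
    using assms(2) by (intro openin_lift_spaceI[OF assms(1)]) auto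
qed

text \<open>Each fibre over \<open>A\<close> is open and carries the topology of a convergent
  sequence. Tails, single terms and complements of points in the fibre are instances.\<close>

lemma openin_lift_space_fibre:
  assumes "uniform_base X P" "a \<in> A" "0 \<in> N \<Longrightarrow> {m<..} \<subseteq> N"
  shows "openin (lift_space X A P) ({a} \<times> N)"
proof (rule openin_lift_spaceI[OF assms(1)])
  fix b assume "(b, 0) \<in> {a} \<times> N"
  then have "seq_tail b m \<subseteq> {a} \<times> N"
    using assms(3) by (auto simp: seq_tail_def)
  then show "\<exists>m. seq_tail b m \<subseteq> {a} \<times> N" ..
qed (use assms(2) in auto)

lemma openin_lift_space_seq_tail:
  assumes "uniform_base X P" "a \<in> A"
  shows "openin (lift_space X A P) (seq_tail a m)"
  unfolding seq_tail_def using assms by (rule openin_lift_space_fibre) auto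

lemma openin_lift_space_singleton:
  assumes "uniform_base X P" "a \<in> A" "k > 0"
  shows "openin (lift_space X A P) {(a, k)}"
  using openin_lift_space_fibre[OF assms(1,2), of "{k}"] assms(3) by simp

lemma openin_lift_space_fibre_minus:
  assumes "uniform_base X P" "a \<in> A"
  shows "openin (lift_space X A P) ({a} \<times> (- {k}))"
  using assms by (rule openin_lift_space_fibre[where m = k]) auto

lemma topspace_lift_space:
  assumes "uniform_base X P"
  shows "topspace (lift_space X A P) = (topspace X - A) \<times> {0} \<union> A \<times> UNIV" (is "_ = ?T")
proof (rule antisym)
  show "topspace (lift_space X A P) \<subseteq> ?T"
    by (rule openin_lift_space_subset[OF assms openin_topspace])
  have "\<exists>U\<in>P. x \<in> U \<and> lift_set A P U \<subseteq> ?T" if x: "x \<in> topspace X" for x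
  proof -
    obtain U where "U \<in> P" "x \<in> U"
      using uniform_base_obtain[OF assms openin_topspace x] .
    moreover have "lift_set A P U \<subseteq> ?T"
      by (rule openin_lift_space_subset[OF assms openin_lift_space_lift_set[OF assms \<open>U \<in> P\<close>]])
    ultimately show ?thesis
      by metis
  qed
  \<comment> \<open>\<open>seq_tail a 0\<close> is the whole fibre over \<open>a\<close>.\<close>
  moreover have "\<exists>m. seq_tail a m \<subseteq> ?T" if "a \<in> A" for a
    using that by (intro exI[of _ 0]) (auto simp: seq_tail_def)
  ultimately have "openin (lift_space X A P) ?T"
    by (intro openin_lift_spaceI[OF assms] order_refl) auto
  then show "?T \<subseteq> topspace (lift_space X A P)"
    by (rule openin_subset)
qed

text \<open>Besides continuity of \<open>fst\<close>, this supplies the open sets that separate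
  points in different fibres.\<close>

lemma openin_lift_space_vimage:
  assumes "uniform_base X P" "A \<subseteq> topspace X" "openin (discretizable_space X A) W"
  shows "openin (lift_space X A P) {p \<in> topspace (lift_space X A P). fst p \<in> W}"
proof -
  have "\<exists>U\<in>P. x \<in> U \<and> lift_set A P U \<subseteq> {p \<in> topspace (lift_space X A P). fst p \<in> W}"
    if x: "x \<notin> A" "x \<in> W" for x
  proof -
    obtain V where V: "openin X V" "x \<in> V" "V \<subseteq> W"
      using assms(3) x unfolding openin_discretizable_space_iff[OF assms(2)] by blast
    obtain U where U: "U \<in> P" "x \<in> U" "U \<subseteq> V"
      using uniform_base_obtain[OF assms(1) V(1,2)] .
    have "fst p \<in> W" if "p \<in> lift_set A P U" for p
      using that fst_lift_set[of A P U] U V by blast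
    then show ?thesis
      using U openin_subset[OF openin_lift_space_lift_set[OF assms(1) U(1), of A]]
      by (intro bexI[OF _ U(1)]) auto
  qed
  moreover have "\<exists>m. seq_tail a m \<subseteq> {p \<in> topspace (lift_space X A P). fst p \<in> W}"
    if "a \<in> A" "a \<in> W" for a
    using that by (intro exI[of _ 0]) (auto simp: topspace_lift_space[OF assms(1)] seq_tail_def)
  moreover have "{p \<in> topspace (lift_space X A P). fst p \<in> W} \<subseteq> (topspace X - A) \<times> {0} \<union> A \<times> UNIV"
    by (auto simp: topspace_lift_space[OF assms(1)])
  ultimately show ?thesis
    by (intro openin_lift_spaceI[OF assms(1)]) auto
qed

section \<open>Separation and the uniform base of the lifted space\<close>

text \<open>Points in different fibres are separated by preimages of open sets of \<open>X\<close>.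
  Two points in one fibre lie over \<open>A\<close>, and one of them has positive index; that point
  is isolated, and the rest of its fibre is open.\<close>

lemma Hausdorff_space_lift_space:
  assumes "uniform_base X P" "A \<subseteq> topspace X" "Hausdorff_space X"
  shows "Hausdorff_space (lift_space X A P)"
  unfolding Hausdorff_space_def
proof (intro allI impI)
  let ?H = "lift_space X A P"
  fix p q assume pq: "p \<in> topspace ?H \<and> q \<in> topspace ?H \<and> p \<noteq> q"
  show "\<exists>U V. openin ?H U \<and> openin ?H V \<and> p \<in> U \<and> q \<in> V \<and> disjnt U V"
  proof (cases "fst p = fst q")
    case False
    have "fst p \<in> topspace X" "fst q \<in> topspace X"
      using pq assms(2) by (auto simp: topspace_lift_space[OF assms(1)])
    then obtain U V where UV: "openin X U" "openin X V" "fst p \<in> U" "fst q \<in> V" "disjnt U V"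
      using assms(3) False unfolding Hausdorff_space_def by meson
    let ?pre = "\<lambda>U. {p \<in> topspace ?H. fst p \<in> U}"
    have "openin (discretizable_space X A) U" "openin (discretizable_space X A) V"
      using UV by (simp_all add: openin_discretizable_space arbitrary_union_of_inc)
    then have "openin ?H (?pre U)" "openin ?H (?pre V)"
      by (simp_all add: openin_lift_space_vimage[OF assms(1,2)])
    moreover have "p \<in> ?pre U" "q \<in> ?pre V" "disjnt (?pre U) (?pre V)"
      using UV pq by (auto simp: disjnt_def)
    ultimately show ?thesis
      by meson
  next
    case True
    then obtain a k j where eq: "p = (a, k)" "q = (a, j)"
      by (metis prod.collapse)
    with pq have a: "a \<in> A" "k \<noteq> j"
      by (auto simp: topspace_lift_space[OF assms(1)])
    have sep: "openin ?H {(a, i)}" "openin ?H ({a} \<times> (- {i}))"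
        "disjnt {(a, i)} ({a} \<times> (- {i}))" if "i > 0" for i
      using that a assms(1)
      by (auto simp: openin_lift_space_singleton openin_lift_space_fibre_minus)
    show ?thesis
    proof (cases "k > 0")
      case True
      have "(a, k) \<in> {(a, k)}" "(a, j) \<in> {a} \<times> (- {k})"
        using a by auto
      with sep[OF True] show ?thesis
        unfolding eq by meson
    next
      case False
      then have "j > 0" "(a, j) \<in> {(a, j)}" "(a, k) \<in> {a} \<times> (- {j})"
        using a by auto
      with sep[OF \<open>j > 0\<close>] show ?thesis
        unfolding eq by (meson disjnt_sym)
    qed
  qed
qed

definition lift_base :: "'a set \<Rightarrow> 'a set set \<Rightarrow> ('a \<times> nat) set set"
  where "lift_base A P = lift_set A P ` P \<union> {seq_tail a m |a m. a \<in> A} \<union>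
    {{(a, k)} |a k. a \<in> A \<and> k > 0}"

lemma uniform_base_lift_base:
  assumes P: "uniform_base X P" and A: "A \<subseteq> topspace X"
  shows "uniform_base (lift_space X A P) (lift_base A P)"
  unfolding uniform_base_iff
proof (intro conjI ballI allI impI)
  let ?H = "lift_space X A P"
  show "openin ?H U" if "U \<in> lift_base A P" for U
    using that P unfolding lift_base_def
    by (auto simp: openin_lift_space_lift_set openin_lift_space_seq_tail openin_lift_space_singleton)
next
  let ?H = "lift_space X A P"
  fix W p assume "openin ?H W \<and> p \<in> W"
  then have W: "openin ?H W" and p: "p \<in> W"
    by auto
  obtain x k where xk: "p = (x, k)"
    by (cases p)
  have top: "p \<in> topspace ?H"
    using W p openin_subset by blast
  show "\<exists>U\<in>lift_base A P. p \<in> U \<and> U \<subseteq> W"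
  proof (cases "x \<in> A")
    case True
    show ?thesis
    proof (cases "k = 0")
      case True
      then obtain m where "seq_tail x m \<subseteq> W"
        using openin_lift_space_obtain_seq_tail[OF P W] p xk \<open>x \<in> A\<close> by metis
      moreover have "seq_tail x m \<in> lift_base A P" "p \<in> seq_tail x m"
        using \<open>x \<in> A\<close> True xk by (auto simp: lift_base_def seq_tail_def)
      ultimately show ?thesis
        by blast
    next
      case False
      then have "{(x, k)} \<in> lift_base A P"
        using \<open>x \<in> A\<close> by (auto simp: lift_base_def)
      then show ?thesis
        using p xk by blast
    qed
  next
    case False
    then have "k = 0"
      using top xk by (auto simp: topspace_lift_space[OF P])
    then obtain U where "U \<in> P" "x \<in> U" "lift_set A P U \<subseteq> W"
      using openin_lift_space_obtain_lift_set[OF P W] p xk False by metis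
    moreover have "p \<in> lift_set A P U"
      using \<open>x \<in> U\<close> False xk \<open>k = 0\<close> by (simp add: lift_set_def)
    ultimately show ?thesis
      by (auto simp: lift_base_def)
  qed
next
  let ?H = "lift_space X A P"
  fix p W Q
  assume "Q \<subseteq> lift_base A P \<and> p \<in> \<Inter>Q \<and> infinite Q \<and> openin ?H W \<and> p \<in> W"
  then have Q: "Q \<subseteq> lift_base A P" "\<And>U. U \<in> Q \<Longrightarrow> p \<in> U" "infinite Q"
    and W: "openin ?H W" and p: "p \<in> W"
    by auto
  obtain x k where xk: "p = (x, k)"
    by (cases p)
  have top: "p \<in> topspace ?H"
    using W p openin_subset by blast
  consider "x \<notin> A" "k = 0" | "x \<in> A" "k = 0" | "x \<in> A" "k > 0"
    using top xk by (auto simp: topspace_lift_space[OF P])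
  then show "\<exists>U\<in>Q. U \<subseteq> W"
  proof cases
    case 1
    define R where "R = {U \<in> P. lift_set A P U \<in> Q}"
    \<comment> \<open>Tails and single terms lie over \<open>A\<close>, so only lifts can contain
      \<open>p\<close>. Thus \<open>R\<close> is infinite, uniformity of \<open>P\<close> applies to
      it, and \<open>lift_set_mono\<close> carries the result upstairs.\<close>
    have "Q \<subseteq> lift_set A P ` R"
    proof
      fix V assume V: "V \<in> Q"
      with Q have "V \<in> lift_base A P" "p \<in> V"
        by auto
      with V 1 show "V \<in> lift_set A P ` R"
        unfolding R_def lift_base_def xk by (auto simp: seq_tail_def)
    qed
    then have "infinite R"
      using Q(3) by (metis finite_imageI finite_subset)
    moreover have "R \<subseteq> P" "x \<in> \<Inter>R"
      using Q(2) 1 unfolding R_def xk by (auto simp: lift_set_def)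
    moreover obtain V where V: "V \<in> P" "x \<in> V" "lift_set A P V \<subseteq> W"
      using openin_lift_space_obtain_lift_set[OF P W] p xk 1 by metis
    moreover have "openin X V"
      using P V by (simp add: uniform_base_openin)
    ultimately obtain U where U: "U \<in> R" "U \<subseteq> V"
      using uniform_base_obtain_infinite[OF P, of R x V] by blast
    then have "lift_set A P U \<subseteq> W"
      using lift_set_mono[OF P _ U(2)] V \<open>R \<subseteq> P\<close> by blast
    then show ?thesis
      using U by (auto simp: R_def)
  next
    case 2
    obtain m where m: "seq_tail x m \<subseteq> W"
      using openin_lift_space_obtain_seq_tail[OF P W] p xk 2 by metis
    \<comment> \<open>Over \<open>A\<close>, lifts omit index 0 and the singletons have positive
      index, so only tails contain the limit.\<close>
    have tails: "V \<in> range (seq_tail x)" if "V \<in> Q" for V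
    proof -
      have "V \<in> lift_base A P" "p \<in> V"
        using Q that by auto
      with 2 show ?thesis
        unfolding lift_base_def xk by (auto simp: seq_tail_def lift_set_def)
    qed
    \<comment> \<open>Being infinite, \<open>Q\<close> must contain a tail that starts at or beyond
      \<open>m\<close>.\<close>
    have "\<not> Q \<subseteq> seq_tail x ` {..m}"
      using Q(3) by (metis finite_atMost finite_imageI finite_subset)
    then obtain V where V: "V \<in> Q" "V \<notin> seq_tail x ` {..m}"
      by blast
    then obtain n where n: "V = seq_tail x n"
      using tails by blast
    with V have "m \<le> n"
      by (meson atMost_iff image_eqI nat_le_linear)
    then have "V \<subseteq> W"
      using m seq_tail_antimono[of m n x] n by simp
    then show ?thesis
      using V by blast
  next
    case 3
    \<comment> \<open>This case is contradictory: the isolated point \<open>(x, k)\<close> lies in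
      only finitely many members of the base. A lift contains it only if its rank is below
      \<open>k\<close>, a tail only if it starts before \<open>k\<close>.\<close>
    let ?F = "lift_set A P ` {U \<in> P. x \<in> U \<and> base_rank P U \<le> k} \<union> seq_tail x ` {..k} \<union> {{(x, k)}}"
    have "Q \<subseteq> ?F"
    proof
      fix V assume "V \<in> Q"
      then have "V \<in> lift_base A P" and V: "(x, k) \<in> V"
        using Q xk by auto
      then consider U where "U \<in> P" "V = lift_set A P U" | a m where "V = seq_tail a m"
        | a j where "V = {(a, j)}"
        unfolding lift_base_def by blast
      then show "V \<in> ?F"
      proof cases
        case 1
        then have "x \<in> U" "base_rank P U \<le> k"
          using V \<open>x \<in> A\<close> by (auto simp: lift_set_def)
        with 1 show ?thesis
          by blast
      next
        case 2
        then have "a = x" "m \<le> k"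
          using V \<open>k > 0\<close> by (auto simp: seq_tail_def)
        with 2 have "V \<in> seq_tail x ` {..k}"
          by (intro image_eqI[of _ _ m]) auto
        then show ?thesis
          by (intro UnI1[OF UnI2])
      next
        case 3
        then have "V = {(x, k)}"
          using V by simp
        then show ?thesis
          by simp
      qed
    qed
    moreover have "finite ?F"
      by (intro finite_UnI finite_imageI finite_base_rank_le[OF P]) auto
    ultimately show ?thesis
      using Q(3) by (meson finite_subset)
  qed
qed

section \<open>The projection: compact, at most boundary-one and open\<close>

lemma fibre_lift_space:
  assumes "uniform_base X P" "A \<subseteq> topspace X" "y \<in> topspace X"
  shows "fibre (lift_space X A P) fst y = (if y \<in> A then {y} \<times> UNIV else {(y, 0)})"
  using assms(2,3) by (auto simp: fibre_def topspace_lift_space[OF assms(1)])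

text \<open>A member of the cover around the limit contains a tail, leaving only finitely many terms
  to cover.\<close>

lemma compactin_lift_space_fibre:
  assumes P: "uniform_base X P" and a: "a \<in> A"
  shows "compactin (lift_space X A P) ({a} \<times> UNIV)"
  unfolding compactin_def
proof (intro conjI allI impI)
  show "{a} \<times> UNIV \<subseteq> topspace (lift_space X A P)"
    using a by (auto simp: topspace_lift_space[OF P])
  fix \<U>
  assume U: "Ball \<U> (openin (lift_space X A P)) \<and> {a} \<times> UNIV \<subseteq> \<Union>\<U>"
  then have "\<exists>V\<in>\<U>. (a, k) \<in> V" for k
    by blast
  then obtain V where V: "\<And>k. V k \<in> \<U>" "\<And>k. (a, k) \<in> V k"
    by metis
  then have "openin (lift_space X A P) (V 0)"
    using U by blast
  then obtain m where m: "seq_tail a m \<subseteq> V 0"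
    using openin_lift_space_obtain_seq_tail[OF P _ V(2) a] by blast
  have "(a, k) \<in> \<Union>(V ` {..m})" for k
  proof (cases "k \<le> m")
    case True
    then show ?thesis
      using V(2)[of k] by blast
  next
    case False
    then have "(a, k) \<in> V 0"
      using m by (auto simp: seq_tail_def)
    then show ?thesis
      by blast
  qed
  then have "{a} \<times> UNIV \<subseteq> \<Union>(V ` {..m})"
    by blast
  then show "\<exists>\<F>. finite \<F> \<and> \<F> \<subseteq> \<U> \<and> {a} \<times> UNIV \<subseteq> \<Union>\<F>"
    using V(1) by (intro exI[of _ "V ` {..m}"]) auto
qed

lemma compact_map_lift_space:
  assumes "uniform_base X P" "A \<subseteq> topspace X"
  shows "compact_map (lift_space X A P) (discretizable_space X A) fst"
  unfolding compact_map_def topspace_discretizable_space[OF assms(2)]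
proof
  fix y assume y: "y \<in> topspace X"
  show "compactin (lift_space X A P) (fibre (lift_space X A P) fst y)"
  proof (cases "y \<in> A")
    case True
    then show ?thesis
      using compactin_lift_space_fibre[OF assms(1)] fibre_lift_space[OF assms y] by simp
  next
    case False
    then show ?thesis
      using y fibre_lift_space[OF assms y]
      by (simp add: compactin_sing topspace_lift_space[OF assms(1)])
  qed
qed

text \<open>Fibres are compact in a Hausdorff space, hence closed. Over \<open>A\<close> they are
  also open, so their boundary is empty; elsewhere they are single points.\<close>

lemma at_most_boundary_one_map_lift_space:
  assumes "uniform_base X P" "A \<subseteq> topspace X" "Hausdorff_space X"
  shows "at_most_boundary_one_map (lift_space X A P) (discretizable_space X A) fst"
  unfolding at_most_boundary_one_map_def topspace_discretizable_space[OF assms(2)]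
proof
  let ?H = "lift_space X A P"
  fix y assume y: "y \<in> topspace X"
  have closed: "closedin ?H (fibre ?H fst y)"
    using assms y compact_map_lift_space[OF assms(1,2)] Hausdorff_space_lift_space[OF assms]
    by (simp add: compact_map_def topspace_discretizable_space compactin_imp_closedin)
  show "\<exists>p. ?H frontier_of fibre ?H fst y \<subseteq> {p}"
  proof (cases "y \<in> A")
    case True
    then have "openin ?H (fibre ?H fst y)"
      using openin_lift_space_fibre[OF assms(1) True] fibre_lift_space[OF assms(1,2) y] by simp
    then have "?H frontier_of fibre ?H fst y = {}"
      using closed by (simp add: frontier_of_eq_empty openin_subset)
    then show ?thesis
      by simp
  next
    case False
    then show ?thesis
      using frontier_of_subset_closedin[OF closed] fibre_lift_space[OF assms(1,2) y] by auto
  qed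
qed

lemma open_map_lift_space:
  assumes P: "uniform_base X P" and A: "A \<subseteq> topspace X"
  shows "open_map (lift_space X A P) (discretizable_space X A) fst"
  unfolding open_map_def
proof (intro allI impI)
  fix W assume W: "openin (lift_space X A P) W"
  then have sub: "W \<subseteq> (topspace X - A) \<times> {0} \<union> A \<times> UNIV"
    by (rule openin_lift_space_subset[OF P])
  have "\<exists>U. openin X U \<and> x \<in> U \<and> U \<subseteq> fst ` W" if x: "x \<in> fst ` W - A" for x
  proof -
    \<comment> \<open>Outside \<open>A\<close> the fibre is a single point, so the preimage of
      \<open>x\<close> in \<open>W\<close> can only be \<open>(x, 0)\<close>.\<close>
    have "(x, 0) \<in> W" "x \<notin> A"
      using x sub by auto
    then obtain U where U: "U \<in> P" "x \<in> U" "lift_set A P U \<subseteq> W"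
      using openin_lift_space_obtain_lift_set[OF P W] by metis
    then have "U \<subseteq> fst ` W"
      using fst_lift_set[of A P U] by blast
    then show ?thesis
      using U uniform_base_openin[OF P] by blast
  qed
  moreover have "fst ` W \<subseteq> topspace X"
    using image_mono[OF sub, of fst] A by (auto simp: image_Un)
  ultimately show "openin (discretizable_space X A) (fst ` W)"
    unfolding openin_discretizable_space_iff[OF A] by metis
qed

theorem theorem3p7:
  fixes X :: "'a topology" and A :: "'a set"
  assumes "Hausdorff_space X"
    and "has_uniform_base X"
    and "A \<subseteq> topspace X"
  shows "\<exists>(H :: ('a \<times> nat) topology) (f :: 'a \<times> nat \<Rightarrow> 'a).
    Hausdorff_space H \<and>
    has_uniform_base H \<and>
    continuous_map H (discretizable_space X A) f \<and>
    f ` topspace H = topspace (discretizable_space X A) \<and>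
    open_map H (discretizable_space X A) f \<and>
    compact_map H (discretizable_space X A) f \<and>
    at_most_boundary_one_map H (discretizable_space X A) f"
proof -
  obtain P where P: "uniform_base X P"
    using assms(2) by (auto simp: has_uniform_base_def)
  let ?H = "lift_space X A P"
  have "has_uniform_base ?H"
    using uniform_base_lift_base[OF P assms(3)] by (auto simp: has_uniform_base_def)
  moreover have onto: "fst ` topspace ?H = topspace (discretizable_space X A)"
    using assms(3)
    by (force simp: topspace_lift_space[OF P] topspace_discretizable_space image_Un)
  moreover have "continuous_map ?H (discretizable_space X A) fst"
    using onto openin_lift_space_vimage[OF P assms(3)] by (auto simp: continuous_map)
  ultimately show ?thesis
    using Hausdorff_space_lift_space[OF P assms(3,1)] open_map_lift_space[OF P assms(3)]
      compact_map_lift_space[OF P assms(3)] at_most_boundary_one_map_lift_space[OF P assms(3,1)]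
    by (intro exI[of _ ?H] exI[of _ fst] conjI)
qed

end
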